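(* Let $\rho>0$ and $\alpha\in(0,1)$. Let $A\in\mathbb{R}^{n\times n}$ and $B\in\mathbb{R}^{n\times m}$, with the property that $\det[(s+\rho)^{\alpha}I-A]\neq 0$ for $s\geq\|A\|^{1/\alpha}$. Then the linear tempered fractional system $$ {}^T D_0^{\alpha,\rho}y(t)=Ay(t)+Bu(t),\qquad y(0)=y_0\in\mathbb{R}^n, $$ is controllable if, and only if, the Kalman matrix $$ K=\left[B,\,AB,\,A^2B,\,\ldots,\,A^{n-1}B\right] $$ has full rank (that is, rank $n$).
   Context: For $\alpha\in(0,1)$ and $\rho>0$, the Caputo tempered fractional derivative of a function $v$ (a $C^1$ function; applied componentwise to vector-valued functions) is $$ {}^T D_0^{\alpha,\rho}v(t)=\frac{1}{\Gamma(1-\alpha)}\int_0^t e^{-\rho(t-s)}(t-s)^{-\alpha}\big(\rho v(s)+v'(s)\big)\,ds, $$ where $\Gamma$ is the Euler gamma function. Here $y$ takes values in $\mathbb{R}^n$ (state) and $u$ takes values in $\mathbb{R}^m$ (input control). The two-parameter Mittag-Leffler function of a square matrix $M$ is $E_{\alpha,\alpha'}(M)=\sum_{l=0}^{\infty}\frac{M^l}{\Gamma(\alpha l+\alpha')}$, for $\alpha,\alpha'>0$. $\|\cdot\|$ is a matrix norm and $I$ is the identity matrix. Definition (controllability): the system is controllable if for some $T>0$ the controllability map $L_T:L^2([0,T];\mathbb{R}^m)\to\mathbb{R}^n$, $$ L_Tu:=\int_0^T e^{-\rho(T-\tau)}(T-\tau)^{\alpha-1}E_{\alpha,\alpha}\big(A(T-\tau)^\alpha\big)Bu(\tau)\,d\tau,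 $$ has $\mathbb{R}^n$ as range. *)

theory Defs
  imports "HOL-Analysis.Analysis"
begin

text \<open>Multiplication on \<open>real^'n^'n\<close> is componentwise, so \<open>A ^ k\<close> is not the matrix power; the
  latter is defined here from the matrix product \<open>**\<close>.\<close>

primrec mat_power :: "real^'n^'n \<Rightarrow> nat \<Rightarrow> real^'n^'n" where
  "mat_power A 0 = mat 1"
| "mat_power A (Suc k) = A ** mat_power A k"

text \<open>A norm on the real vector space of \<open>n\<times>n\<close> matrices; submultiplicativity is not demanded, so
  every reading of "matrix norm" is an instance.\<close>

definition matrix_norm :: "(real^'n^'n \<Rightarrow> real) \<Rightarrow> bool" where
  "matrix_norm N \<longleftrightarrow>
     (\<forall>X. 0 \<le> N X) \<and> (\<forall>X. N X = 0 \<longleftrightarrow> X = 0) \<and>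
     (\<forall>c X. N (c *\<^sub>R X) = \<bar>c\<bar> * N X) \<and> (\<forall>X Y. N (X + Y) \<le> N X + N Y)"

definition mittag_leffler :: "real \<Rightarrow> real \<Rightarrow> real^'n^'n \<Rightarrow> real^'n^'n" where
  "mittag_leffler \<alpha> \<beta> M = (\<Sum>l. (1 / Gamma (\<alpha> * real l + \<beta>)) *\<^sub>R mat_power M l)"

definition C1_on_half_line :: "(real \<Rightarrow> real^'n) \<Rightarrow> bool" where
  "C1_on_half_line v \<longleftrightarrow>
     (\<forall>t\<ge>0. v differentiable (at t within {0..})) \<and>
     continuous_on {0..} (\<lambda>t. vector_derivative v (at t within {0..}))"

definition caputo_tempered_deriv :: "real \<Rightarrow> real \<Rightarrow> (real \<Rightarrow> real^'n) \<Rightarrow> real \<Rightarrow> real^'n" where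
  "caputo_tempered_deriv \<alpha> \<rho> v t =
     (1 / Gamma (1 - \<alpha>)) *\<^sub>R
       integral\<^sup>L (lebesgue_on {0..t})
         (\<lambda>s. (exp (- \<rho> * (t - s)) * (t - s) powr (- \<alpha>)) *\<^sub>R
              (\<rho> *\<^sub>R v s + vector_derivative v (at s within {0..})))"

record ('n::finite, 'm::finite) tempered_system =
  sys_order :: real
  sys_tempering :: real
  sys_state :: "real^'n^'n"
  sys_input :: "real^'m^'n"

text \<open>The dynamics a \<open>tempered_system\<close> stands for. Controllability below is a property of the
  controllability map, which depends on the data of the system but not on \<open>y0\<close>.\<close>

definition solves ::
  "('n::finite, 'm::finite) tempered_system \<Rightarrow> (real \<Rightarrow> real^'m) \<Rightarrow> real^'n \<Rightarrow> (real \<Rightarrow> real^'n) \<Rightarrow> bool" where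
  "solves S u y0 y \<longleftrightarrow>
     C1_on_half_line y \<and> y 0 = y0 \<and>
     (\<forall>t>0. caputo_tempered_deriv (sys_order S) (sys_tempering S) y t
            = sys_state S *v y t + sys_input S *v u t)"

definition L2_controls :: "real \<Rightarrow> (real \<Rightarrow> real^'m) set" where
  "L2_controls T = {u. u \<in> borel_measurable (lebesgue_on {0..T}) \<and>
                       integrable (lebesgue_on {0..T}) (\<lambda>t. (norm (u t))\<^sup>2)}"

definition control_integrand ::
  "('n::finite, 'm::finite) tempered_system \<Rightarrow> real \<Rightarrow> (real \<Rightarrow> real^'m) \<Rightarrow> real \<Rightarrow> real^'n" where
  "control_integrand S T u \<tau> =
     (exp (- sys_tempering S * (T - \<tau>)) * (T - \<tau>) powr (sys_order S - 1)) *\<^sub>R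
       ((mittag_leffler (sys_order S) (sys_order S) ((T - \<tau>) powr sys_order S *\<^sub>R sys_state S)
         ** sys_input S) *v u \<tau>)"

definition controllability_map ::
  "('n::finite, 'm::finite) tempered_system \<Rightarrow> real \<Rightarrow> (real \<Rightarrow> real^'m) \<Rightarrow> real^'n" where
  "controllability_map S T u = integral\<^sup>L (lebesgue_on {0..T}) (control_integrand S T u)"

text \<open>For order \<open>\<alpha> \<le> 1/2\<close> the kernel \<open>(T - \<tau>) powr (\<alpha> - 1)\<close> is not square integrable, so the integral
  need not exist for every square-integrable \<open>u\<close>; the map is then taken on those \<open>u\<close> for which it
  does. For \<open>\<alpha> > 1/2\<close> this is no restriction. (The Bochner integral of a non-integrable function
  is \<open>0\<close>, the image of \<open>u = 0\<close>, so the range is the same with or without the restriction.)\<close>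

definition control_domain :: "('n::finite, 'm::finite) tempered_system \<Rightarrow> real \<Rightarrow> (real \<Rightarrow> real^'m) set" where
  "control_domain S T =
     {u \<in> L2_controls T. integrable (lebesgue_on {0..T}) (control_integrand S T u)}"

definition controllable :: "('n::finite, 'm::finite) tempered_system \<Rightarrow> bool" where
  "controllable S \<longleftrightarrow> (\<exists>T>0. controllability_map S T ` control_domain S T = UNIV)"

text \<open>The \<open>n\<times>(nm)\<close> matrix \<open>[B, AB, \<dots>, A\<^sup>n\<^sup>-\<^sup>1B]\<close>. Its columns are indexed by pairs: column \<open>(k, j)\<close> is
  the \<open>j\<close>-th column of the block with number \<open>block_number k\<close>, where \<open>block_number\<close> enumerates the
  index type \<open>'n\<close> by \<open>0, \<dots>, n - 1\<close>. The choice of enumeration only permutes the blocks.\<close>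

definition block_number :: "'n::finite \<Rightarrow> nat" where
  "block_number = to_nat_on UNIV"

lemma bij_betw_block_number: "bij_betw block_number (UNIV :: 'n::finite set) {..<CARD('n)}"
  unfolding block_number_def by (rule to_nat_on_finite) simp

definition kalman_matrix :: "real^'n^'n \<Rightarrow> real^'m^'n \<Rightarrow> real^('n \<times> 'm)^'n" where
  "kalman_matrix A B = (\<chi> i p. (mat_power A (block_number (fst p)) ** B) $ i $ snd p)"

end

theory Submission
  imports Defs "HOL-Real_Asymp.Real_Asymp"
begin

text \<open>
  Write \<open>F s = E (s\<^sup>\<alpha> A) B\<close> with \<open>E\<close> the Mittag-Leffler function with both parameters \<open>\<alpha>\<close>. The
  controllability map integrates \<open>e\<^sup>-\<^sup>\<rho>\<^sup>s s\<^sup>\<alpha>\<^sup>-\<^sup>1 F s\<close> against the time-reversed control. In the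
  variable \<open>z = s\<^sup>\<alpha>\<close> each scalar \<open>\<eta> \<bullet> F s w\<close> is an entire power series whose coefficients are
  \<open>\<eta> \<bullet> A\<^sup>l B w\<close> times positive numbers (\<open>inner_mittag_leffler_sums\<close>), so it vanishes for all small
  \<open>s > 0\<close> if and only if all these coefficients vanish. A Krylov space argument reduces
  the coefficients to the indices \<open>l < n\<close>; hence the Kalman matrix has rank \<open>n\<close> exactly if no
  nonzero \<open>\<eta>\<close> annihilates all \<open>A\<^sup>l B\<close> (\<open>rank_kalman_matrix_full_iff\<close>).

  If some nonzero \<open>\<eta>\<close> does so, it is orthogonal to the integrand, hence to the range of the
  controllability map for every \<open>T\<close>, and the system is not controllable. Conversely, for \<open>T = 1\<close>
  the controls \<open>s (F s)\<^sup>T p\<close> are mapped to \<open>W p\<close>, where \<open>W\<close> is the integral of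
  \<open>e\<^sup>-\<^sup>\<rho>\<^sup>s s\<^sup>\<alpha> F s (F s)\<^sup>T\<close> over \<open>[0, 1]\<close>, a weighted Gramian. If \<open>W p = 0\<close>, then \<open>p \<bullet> W p\<close> is the
  integral of a continuous nonnegative function and forces \<open>(F s)\<^sup>T p = 0\<close> for \<open>0 < s < 1\<close>, so that
  \<open>p\<close> annihilates all \<open>A\<^sup>l B\<close> (\<open>gramian_kernel\<close>). Under the rank condition \<open>W\<close> is therefore
  injective, hence surjective.
\<close>

section \<open>Powers of a linear map and the Kalman matrix\<close>

text \<open>Among the \<open>n + 1\<close> vectors \<open>b, f b, \<dots>, f\<^sup>n b\<close> one lies in the span of its predecessors.
  That span is then invariant under \<open>f\<close> and so contains the whole orbit of \<open>b\<close>. This replaces an appeal to the Cayley-Hamilton theorem.\<close>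

lemma funpow_in_span_funpow_lessThan_DIM:
  fixes f :: "'a::euclidean_space \<Rightarrow> 'a"
  assumes "linear f"
  shows "(f ^^ l) b \<in> span ((\<lambda>j. (f ^^ j) b) ` {..<DIM('a)})"
proof -
  let ?V = "\<lambda>k. (\<lambda>j. (f ^^ j) b) ` {..<k}"
  have "\<exists>k\<le>DIM('a). (f ^^ k) b \<in> span (?V k)"
  proof (rule ccontr)
    assume "\<not> ?thesis"
    then have new: "(f ^^ k) b \<notin> span (?V k)" if "k \<le> DIM('a)" for k
      using that by blast
    have "independent (?V k) \<and> card (?V k) = k" if "k \<le> Suc DIM('a)" for k
      using that
    proof (induction k)
      case (Suc k)
      then have IH: "independent (?V k)" "card (?V k) = k" and k: "k \<le> DIM('a)"
        by auto
      have "(f ^^ k) b \<notin> ?V k"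
        using new[OF k] span_base[of "(f ^^ k) b" "?V k"] by (rule contrapos_nn)
      then show ?case
        using IH independent_insertI[OF new[OF k] IH(1)] by (simp add: lessThan_Suc)
    qed (simp add: independent_empty)
    from this[of "Suc DIM('a)"] show False
      using independent_bound[of "?V (Suc DIM('a))"] by linarith
  qed
  then obtain k where k: "k \<le> DIM('a)" and dep: "(f ^^ k) b \<in> span (?V k)"
    by blast
  have invariant: "f x \<in> span (?V k)" if "x \<in> span (?V k)" for x
  proof -
    have "f x \<in> span (f ` ?V k)"
      using that by (simp add: linear_span_image[OF assms])
    moreover have "f ` ?V k \<subseteq> span (?V k)"
    proof clarsimp
      fix j assume "j < k"
      then consider "Suc j < k" | "Suc j = k"
        by linarith
      then have "(f ^^ Suc j) b \<in> span (?V k)"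
      proof cases
        case 1
        then show ?thesis
          by (intro span_base imageI) simp
      qed (use dep in simp)
      then show "f ((f ^^ j) b) \<in> span (?V k)"
        by simp
    qed
    ultimately show ?thesis
      using span_minimal[OF _ subspace_span] by (meson subsetD)
  qed
  have "(f ^^ l) b \<in> span (?V k)"
  proof (induction l)
    case 0
    show ?case
    proof (cases "k = 0")
      case False
      then have "b \<in> ?V k"
        by (intro image_eqI[of _ _ 0]) auto
      then show ?thesis
        by (simp add: span_base)
    qed (use dep in simp)
  qed (simp add: invariant)
  moreover have "?V k \<subseteq> ?V DIM('a)"
    using k by (intro image_mono) auto
  ultimately show ?thesis
    using span_mono by (meson subsetD)
qed

lemma mat_power_vector_mult: "mat_power A l *v b = ((*v) A ^^ l) b"
  by (induction l) (simp_all flip: matrix_vector_mul_assoc)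

lemma mat_power_scaleR: "mat_power (z *\<^sub>R A) l = z ^ l *\<^sub>R mat_power A l"
proof (induction l)
  case (Suc l)
  have "(z *\<^sub>R A) ** (z ^ l *\<^sub>R mat_power A l) = z ^ Suc l *\<^sub>R (A ** mat_power A l)"
    by (simp add: matrix_scalar_ac flip: scalar_matrix_assoc)
  with Suc show ?case
    by simp
qed simp

lemma inner_mat_power_zero_if_lessThan:
  fixes A :: "real^'n^'n"
  assumes "\<And>k. k < CARD('n) \<Longrightarrow> \<eta> \<bullet> (mat_power A k *v b) = 0"
  shows "\<eta> \<bullet> (mat_power A l *v b) = 0"
proof -
  have "mat_power A l *v b \<in> span ((\<lambda>k. mat_power A k *v b) ` {..<CARD('n)})"
    using funpow_in_span_funpow_lessThan_DIM[of "(*v) A" l b]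
    by (simp add: mat_power_vector_mult)
  moreover have "span ((\<lambda>k. mat_power A k *v b) ` {..<CARD('n)}) \<subseteq> {x. \<eta> \<bullet> x = 0}"
    using assms by (intro span_minimal subspace_hyperplane) auto
  ultimately show ?thesis
    by blast
qed

lemma transpose_vector_mult_eq_0_iff:
  fixes M :: "real^'m^'n"
  shows "transpose M *v \<eta> = 0 \<longleftrightarrow> (\<forall>w. \<eta> \<bullet> (M *v w) = 0)"
proof -
  have "\<eta> \<bullet> (M *v w) = (transpose M *v \<eta>) \<bullet> w" for w
    by (simp flip: dot_lmul_matrix)
  then show ?thesis
    by (metis inner_eq_zero_iff inner_zero_left)
qed

lemma transpose_kalman_matrix_vector_mult:
  "(transpose (kalman_matrix A B) *v \<eta>) $ (k, j)
    = (transpose (mat_power A (block_number k) ** B) *v \<eta>) $ j"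
  by (simp add: matrix_vector_mult_def transpose_def kalman_matrix_def)

text \<open>Full row rank means that the transpose is injective, and \<open>\<eta>\<close> lies in its kernel if and only if
  \<open>\<eta>\<close> annihilates the blocks \<open>A\<^sup>l B\<close> with \<open>l < n\<close>, thus by the previous results all of them.\<close>

lemma rank_kalman_matrix_full_iff:
  fixes A :: "real^'n^'n" and B :: "real^'m^'n"
  shows "rank (kalman_matrix A B) = CARD('n)
    \<longleftrightarrow> (\<forall>\<eta>. (\<forall>l w. \<eta> \<bullet> ((mat_power A l ** B) *v w) = 0) \<longrightarrow> \<eta> = 0)"
proof -
  have kernel: "transpose (kalman_matrix A B) *v \<eta> = 0
      \<longleftrightarrow> (\<forall>l w. \<eta> \<bullet> ((mat_power A l ** B) *v w) = 0)" for \<eta>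
  proof -
    have "transpose (kalman_matrix A B) *v \<eta> = 0
        \<longleftrightarrow> (\<forall>k::'n. transpose (mat_power A (block_number k) ** B) *v \<eta> = 0)"
      by (simp only: vec_eq_iff split_paired_All transpose_kalman_matrix_vector_mult zero_index)
    also have "\<dots> \<longleftrightarrow> (\<forall>k\<in>range (block_number :: 'n \<Rightarrow> nat). \<forall>w. \<eta> \<bullet> ((mat_power A k ** B) *v w) = 0)"
      by (simp only: transpose_vector_mult_eq_0_iff ball_simps)
    also have "range (block_number :: 'n \<Rightarrow> nat) = {..<CARD('n)}"
      using bij_betw_block_number by (rule bij_betw_imp_surj_on)
    also have "(\<forall>k\<in>{..<CARD('n)}. \<forall>w. \<eta> \<bullet> ((mat_power A k ** B) *v w) = 0)
        \<longleftrightarrow> (\<forall>l w. \<eta> \<bullet> ((mat_power A l ** B) *v w) = 0)"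
    proof (intro iffI allI)
      fix l w
      assume "\<forall>k\<in>{..<CARD('n)}. \<forall>w. \<eta> \<bullet> ((mat_power A k ** B) *v w) = 0"
      then have "\<eta> \<bullet> (mat_power A k *v (B *v w)) = 0" if "k < CARD('n)" for k
        using that by (simp add: matrix_vector_mul_assoc)
      then have "\<eta> \<bullet> (mat_power A l *v (B *v w)) = 0"
        by (rule inner_mat_power_zero_if_lessThan)
      then show "\<eta> \<bullet> ((mat_power A l ** B) *v w) = 0"
        by (simp add: matrix_vector_mul_assoc)
    qed simp
    finally show ?thesis .
  qed
  have "rank (kalman_matrix A B) = CARD('n)
      \<longleftrightarrow> (\<forall>\<eta>. transpose (kalman_matrix A B) *v \<eta> = 0 \<longrightarrow> \<eta> = 0)"
    using full_rank_injective[of "transpose (kalman_matrix A B)"]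
      linear_injective_0[OF matrix_vector_mul_linear[of "transpose (kalman_matrix A B)"]]
    by (simp only: rank_transpose)
  then show ?thesis
    by (simp only: kernel)
qed

section \<open>The Mittag-Leffler function as an entire power series\<close>

text \<open>Since \<open>ln Gamma\<close> is convex, its slope over \<open>[x, x + a]\<close> is at least its slope over \<open>[x - 1, x]\<close>,
  which is \<open>ln (x - 1)\<close> by the functional equation.\<close>

lemma Gamma_real_add_ge:
  fixes x a :: real
  assumes "1 < x" "0 < a"
  shows "(x - 1) powr a * Gamma x \<le> Gamma (x + a)"
proof -
  let ?f = "ln \<circ> Gamma :: real \<Rightarrow> real"
  have pos: "0 < Gamma (x - 1)" "0 < Gamma x" "0 < Gamma (x + a)"
    using assms by (auto intro: Gamma_real_pos)
  have "(?f (x - 1) - ?f x) / ((x - 1) - x) \<le> (?f x - ?f (x + a)) / (x - (x + a))"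
    using order_trans[OF convex_on_slope_le[OF log_convex_Gamma_real, of "x - 1" "x + a" x]]
      assms by simp
  then have "ln (Gamma x) - ln (Gamma (x - 1)) \<le> (ln (Gamma (x + a)) - ln (Gamma x)) / a"
    by (simp add: minus_divide_left)
  moreover have "Gamma x = (x - 1) * Gamma (x - 1)"
    using Gamma_plus1[of "x - 1"] nonpos_Ints_nonpos[of "x - 1"] assms
    by (cases "x - 1 \<in> \<int>\<^sub>\<le>\<^sub>0") auto
  then have "ln (Gamma x) = ln (x - 1) + ln (Gamma (x - 1))"
    using assms pos ln_mult_pos[of "x - 1" "Gamma (x - 1)"] by simp
  ultimately have "a * ln (x - 1) + ln (Gamma x) \<le> ln (Gamma (x + a))"
    using assms by (simp add: field_simps)
  then have "exp (a * ln (x - 1) + ln (Gamma x)) \<le> exp (ln (Gamma (x + a)))"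
    by simp
  then show ?thesis
    using assms pos by (simp add: exp_add powr_def)
qed

text \<open>By the preceding estimate the quotient of successive coefficients tends to zero, which makes the
  Mittag-Leffler series entire.\<close>

lemma summable_powser_inverse_Gamma:
  fixes R :: real
  assumes "0 < \<alpha>" "0 < \<beta>"
  shows "summable (\<lambda>l. 1 / Gamma (\<alpha> * real l + \<beta>) * R ^ l)"
proof -
  have "filterlim (\<lambda>l. (\<alpha> * real l + \<beta> - 1) powr \<alpha>) at_top sequentially"
    using assms by real_asymp
  \<comment> \<open>twice \<open>\<bar>R\<bar>\<close> gives the ratio \<open>1/2\<close>\<close>
  then have "\<forall>\<^sub>F l in sequentially. 2 * \<bar>R\<bar> \<le> (\<alpha> * real l + \<beta> - 1) powr \<alpha>"
    by (simp add: filterlim_at_top)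
  moreover have "\<forall>\<^sub>F l in sequentially. 1 < \<alpha> * real l + \<beta>"
    using assms by real_asymp
  ultimately have "\<forall>\<^sub>F l in sequentially. 2 * \<bar>R\<bar> \<le> (\<alpha> * real l + \<beta> - 1) powr \<alpha>
      \<and> 1 < \<alpha> * real l + \<beta>"
    by eventually_elim simp
  then obtain L where L: "\<And>l. l \<ge> L \<Longrightarrow> 2 * \<bar>R\<bar> \<le> (\<alpha> * real l + \<beta> - 1) powr \<alpha>"
      "\<And>l. l \<ge> L \<Longrightarrow> 1 < \<alpha> * real l + \<beta>"
    by (auto simp: eventually_sequentially)
  show ?thesis
  proof (rule summable_ratio_test[of "1/2" L])
    fix l assume "L \<le> l"
    define x where "x = \<alpha> * real l + \<beta>"
    have x: "1 < x" "2 * \<bar>R\<bar> \<le> (x - 1) powr \<alpha>"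
      using L[OF \<open>L \<le> l\<close>] by (auto simp: x_def)
    have pos: "0 < Gamma x" "0 < Gamma (x + \<alpha>)"
      using x assms by (auto intro: Gamma_real_pos)
    have "2 * \<bar>R\<bar> * Gamma x \<le> (x - 1) powr \<alpha> * Gamma x"
      using x pos by (intro mult_right_mono) auto
    also have "\<dots> \<le> Gamma (x + \<alpha>)"
      by (rule Gamma_real_add_ge) (use x assms in auto)
    finally have "\<bar>R\<bar> / Gamma (x + \<alpha>) \<le> 1 / 2 * (1 / Gamma x)"
      using pos by (simp add: field_simps)
    then have "\<bar>R\<bar> ^ l * (\<bar>R\<bar> / Gamma (x + \<alpha>)) \<le> \<bar>R\<bar> ^ l * (1 / 2 * (1 / Gamma x))"
      by (intro mult_left_mono) auto
    moreover have "\<alpha> * real (Suc l) + \<beta> = x + \<alpha>"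
      by (simp add: x_def algebra_simps)
    ultimately show "norm (1 / Gamma (\<alpha> * real (Suc l) + \<beta>) * R ^ Suc l)
        \<le> 1 / 2 * norm (1 / Gamma (\<alpha> * real l + \<beta>) * R ^ l)"
      using pos by (simp add: x_def[symmetric] abs_mult power_abs mult_ac)
  qed simp
qed

lemma norm_mat_power_le:
  fixes A :: "real^'n^'n"
  obtains K where "0 < K" "\<And>l. norm (mat_power A l) \<le> norm (mat 1 :: real^'n^'n) * K ^ l"
proof -
  have "linear (\<lambda>X. A ** X :: real^'n^'n)"
    by (intro linearI) (simp_all add: matrix_add_ldistrib matrix_scalar_ac flip: scalar_matrix_assoc)
  then obtain K where K: "0 < K" "\<And>X :: real^'n^'n. norm (A ** X) \<le> K * norm X"
    using linear_bounded_pos by blast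
  have "norm (mat_power A l) \<le> norm (mat 1 :: real^'n^'n) * K ^ l" for l
  proof (induction l)
    case (Suc l)
    have "norm (mat_power A (Suc l)) \<le> K * norm (mat_power A l)"
      by (simp add: K)
    also have "\<dots> \<le> K * (norm (mat 1 :: real^'n^'n) * K ^ l)"
      using Suc K by (intro mult_left_mono) auto
    finally show ?case
      by (simp add: mult_ac)
  qed simp
  with K show ?thesis
    using that by blast
qed

text \<open>Coordinate functionals and the functionals \<open>X \<mapsto> \<eta> \<bullet> X B w\<close> both have to be evaluated at the
  Mittag-Leffler function; each of them turns it into a scalar power series.\<close>

lemma linear_mittag_leffler_sums:
  fixes A :: "real^'n^'n" and \<phi> :: "real^'n^'n \<Rightarrow> real"
  assumes "0 < \<alpha>" "0 < \<beta>" "linear \<phi>"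
  shows "(\<lambda>l. \<phi> (mat_power A l) / Gamma (\<alpha> * real l + \<beta>) * z ^ l)
    sums \<phi> (mittag_leffler \<alpha> \<beta> (z *\<^sub>R A))"
proof -
  obtain K where K: "0 < K" "\<And>l. norm (mat_power A l) \<le> norm (mat 1 :: real^'n^'n) * K ^ l"
    using norm_mat_power_le[of A] by blast
  let ?t = "\<lambda>l. (1 / Gamma (\<alpha> * real l + \<beta>)) *\<^sub>R mat_power (z *\<^sub>R A) l"
  have "summable ?t"
  proof (rule summable_comparison_test')
    show "summable (\<lambda>l. norm (mat 1 :: real^'n^'n) *
        (1 / Gamma (\<alpha> * real l + \<beta>) * (K * \<bar>z\<bar>) ^ l))"
      using assms by (intro summable_mult summable_powser_inverse_Gamma)
  next
    fix l :: nat
    have "0 < Gamma (\<alpha> * real l + \<beta>)"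
      using assms by (intro Gamma_real_pos) (simp add: add_nonneg_pos)
    then show "norm (?t l) \<le> norm (mat 1 :: real^'n^'n) *
        (1 / Gamma (\<alpha> * real l + \<beta>) * (K * \<bar>z\<bar>) ^ l)"
      using mult_left_mono[OF K(2)[of l], of "\<bar>z\<bar> ^ l / Gamma (\<alpha> * real l + \<beta>)"]
      by (simp add: mat_power_scaleR power_abs power_mult_distrib mult_ac)
  qed
  then have "?t sums mittag_leffler \<alpha> \<beta> (z *\<^sub>R A)"
    unfolding mittag_leffler_def by (rule summable_sums)
  from bounded_linear.sums[OF assms(3)[unfolded linear_conv_bounded_linear] this]
  have "(\<lambda>l. \<phi> (?t l)) sums \<phi> (mittag_leffler \<alpha> \<beta> (z *\<^sub>R A))" .
  moreover have "\<phi> (?t l) = \<phi> (mat_power A l) / Gamma (\<alpha> * real l + \<beta>) * z ^ l" for l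
    by (simp add: mat_power_scaleR linear_cmul[OF assms(3)])
  ultimately show ?thesis
    by simp
qed

lemma continuous_mittag_leffler_scaleR:
  fixes A :: "real^'n^'n"
  assumes "0 < \<alpha>" "0 < \<beta>"
  shows "continuous_on S (\<lambda>z. mittag_leffler \<alpha> \<beta> (z *\<^sub>R A))"
proof -
  have "continuous_on S (\<lambda>z. mittag_leffler \<alpha> \<beta> (z *\<^sub>R A) $ i $ j)" for i j
  proof -
    have "linear (\<lambda>X :: real^'n^'n. X $ i $ j)"
      by (intro linearI) auto
    note sums = linear_mittag_leffler_sums[OF assms this, of A]
    have "isCont (\<lambda>z. \<Sum>l. mat_power A l $ i $ j / Gamma (\<alpha> * real l + \<beta>) * z ^ l) z" for z
      using sums by (intro isCont_powser_converges_everywhere) (rule sums_summable)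
    moreover have "(\<lambda>z. mittag_leffler \<alpha> \<beta> (z *\<^sub>R A) $ i $ j)
        = (\<lambda>z. \<Sum>l. mat_power A l $ i $ j / Gamma (\<alpha> * real l + \<beta>) * z ^ l)"
      by (rule ext, rule sums_unique) (rule sums)
    ultimately show ?thesis
      by (simp add: continuous_at_imp_continuous_on)
  qed
  then have "continuous_on S (\<lambda>z. \<chi> i j. mittag_leffler \<alpha> \<beta> (z *\<^sub>R A) $ i $ j)"
    by (intro continuous_on_vec_lambda)
  then show ?thesis
    by (simp add: vec_lambda_eta)
qed

text \<open>At zero the series is continuous, so its one-sided limit there is its constant term. Once this
  term is known to vanish, the series can be divided by its variable, and the induction
  continues with the shifted coefficients. Vanishing is assumed on the right of zero only, because the
  intended variable \<open>z = s\<^sup>\<alpha>\<close> takes no negative values.\<close>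

lemma powser_zero_right_nbhd_imp_coeffs_zero:
  fixes a :: "nat \<Rightarrow> real"
  assumes "0 < r" and "\<And>z. summable (\<lambda>n. a n * z ^ n)"
    and "\<And>z. 0 < z \<Longrightarrow> z < r \<Longrightarrow> (\<Sum>n. a n * z ^ n) = 0"
  shows "a k = 0"
proof -
  have head: "a 0 = 0" if "\<And>z. summable (\<lambda>n. a n * z ^ n)"
    and zero: "\<And>z. 0 < z \<Longrightarrow> z < r \<Longrightarrow> (\<Sum>n. a n * z ^ n) = 0" for a :: "nat \<Rightarrow> real"
  proof -
    have "isCont (\<lambda>z. \<Sum>n. a n * z ^ n) 0"
      using that(1) by (rule isCont_powser_converges_everywhere)
    then have "((\<lambda>z. \<Sum>n. a n * z ^ n) \<longlongrightarrow> a 0) (at_right 0)"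
      by (simp add: isCont_def filterlim_at_split)
    moreover have "\<forall>\<^sub>F z in at_right 0. (\<Sum>n. a n * z ^ n) = 0"
      using zero \<open>0 < r\<close> by (auto simp: eventually_at_right)
    then have "((\<lambda>z. \<Sum>n. a n * z ^ n) \<longlongrightarrow> 0) (at_right 0)"
      by (rule tendsto_eventually)
    ultimately show ?thesis
      using tendsto_unique trivial_limit_at_right_real by blast
  qed
  show ?thesis
    using assms(2,3)
  proof (induction k arbitrary: a)
    case (Suc k)
    have tail: "summable (\<lambda>n. a (Suc n) * z ^ n)" for z
      using Suc.prems(1) by (simp add: summable_powser_split_head)
    have "(\<Sum>n. a (Suc n) * z ^ n) = 0" if "0 < z" "z < r" for z
      using powser_split_head(1)[OF Suc.prems(1), of z] head[OF Suc.prems] Suc.prems(2)[OF that] that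
      by simp
    then show ?case
      using Suc.IH[of "\<lambda>n. a (Suc n)"] tail by blast
  qed (rule head)
qed

section \<open>Controllability\<close>

lemma linear_inner_mult_vector:
  fixes B :: "real^'m^'n"
  shows "linear (\<lambda>X :: real^'n^'n. \<eta> \<bullet> ((X ** B) *v w))"
proof -
  have "linear (\<lambda>X :: real^'n^'n. X *v (B *v w))"
    by (intro linearI) (simp_all add: matrix_vector_mult_add_rdistrib scaleR_matrix_vector_assoc)
  then show ?thesis
    by (simp add: linear_iff inner_add_right flip: matrix_vector_mul_assoc)
qed

lemma inner_mittag_leffler_sums:
  fixes A :: "real^'n^'n" and B :: "real^'m^'n"
  assumes "0 < \<alpha>" "0 < \<beta>"
  shows "(\<lambda>l. \<eta> \<bullet> ((mat_power A l ** B) *v w) / Gamma (\<alpha> * real l + \<beta>) * z ^ l)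
    sums (\<eta> \<bullet> ((mittag_leffler \<alpha> \<beta> (z *\<^sub>R A) ** B) *v w))"
  using linear_mittag_leffler_sums[OF assms linear_inner_mult_vector] .

lemma inner_mittag_leffler_zero_if_powers:
  fixes A :: "real^'n^'n" and B :: "real^'m^'n"
  assumes "0 < \<alpha>" "0 < \<beta>" and "\<And>l. \<eta> \<bullet> ((mat_power A l ** B) *v w) = 0"
  shows "\<eta> \<bullet> ((mittag_leffler \<alpha> \<beta> (z *\<^sub>R A) ** B) *v w) = 0"
  using sums_unique[OF inner_mittag_leffler_sums[OF assms(1,2), of \<eta> A B w z]] assms(3) by simp

lemma inner_powers_zero_if_mittag_leffler:
  fixes A :: "real^'n^'n" and B :: "real^'m^'n"
  assumes "0 < \<alpha>" "0 < \<beta>" "0 < r"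
    and zero: "\<And>z. 0 < z \<Longrightarrow> z < r \<Longrightarrow> \<eta> \<bullet> ((mittag_leffler \<alpha> \<beta> (z *\<^sub>R A) ** B) *v w) = 0"
  shows "\<eta> \<bullet> ((mat_power A l ** B) *v w) = 0"
proof -
  note sums = inner_mittag_leffler_sums[OF assms(1,2), of \<eta> A B w]
  have "\<eta> \<bullet> ((mat_power A l ** B) *v w) / Gamma (\<alpha> * real l + \<beta>) = 0"
  proof (rule powser_zero_right_nbhd_imp_coeffs_zero[OF \<open>0 < r\<close> sums_summable[OF sums]])
    fix z assume "0 < z" "z < r"
    then show "(\<Sum>l. \<eta> \<bullet> ((mat_power A l ** B) *v w) / Gamma (\<alpha> * real l + \<beta>) * z ^ l) = 0"
      using sums_unique[OF sums, of z] zero by simp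
  qed
  moreover have "0 < Gamma (\<alpha> * real l + \<beta>)"
    using assms by (intro Gamma_real_pos) (simp add: add_nonneg_pos)
  ultimately show ?thesis
    by simp
qed

context
  fixes A :: "real^'n^'n" and B :: "real^'m^'n" and \<alpha> \<rho> :: real
  assumes \<alpha>_pos: "0 < \<alpha>"
begin

abbreviation (input) system :: "('n, 'm) tempered_system" where
  "system \<equiv> \<lparr>sys_order = \<alpha>, sys_tempering = \<rho>, sys_state = A, sys_input = B\<rparr>"

definition response :: "real \<Rightarrow> real^'m^'n" where
  "response s = mittag_leffler \<alpha> \<alpha> (s powr \<alpha> *\<^sub>R A) ** B"

text \<open>The factor \<open>1 - \<tau>\<close> compensates the singularity \<open>(1 - \<tau>) powr (\<alpha> - 1)\<close> of the kernel. Both the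
  control and the resulting integrand are then continuous on \<open>[0, 1]\<close>, whether or not the kernel
  itself is square integrable.\<close>

definition gramian_control :: "real^'n \<Rightarrow> real \<Rightarrow> real^'m" where
  "gramian_control p \<tau> = (1 - \<tau>) *\<^sub>R (transpose (response (1 - \<tau>)) *v p)"

lemma control_integrand_system:
  "control_integrand system T u \<tau>
    = (exp (- \<rho> * (T - \<tau>)) * (T - \<tau>) powr (\<alpha> - 1)) *\<^sub>R (response (T - \<tau>) *v u \<tau>)"
  by (simp add: control_integrand_def response_def)

lemma continuous_on_response: "continuous_on {0..} response"
proof -
  have "continuous_on {0..} (\<lambda>s :: real. s powr \<alpha>)"
    using \<alpha>_pos by (intro continuous_on_powr' continuous_intros) auto
  then have "continuous_on {0..} (\<lambda>s. mittag_leffler \<alpha> \<alpha> (s powr \<alpha> *\<^sub>R A))"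
    by (rule continuous_on_compose2[OF continuous_mittag_leffler_scaleR[OF \<alpha>_pos \<alpha>_pos, of UNIV A]])
      simp
  then show ?thesis
    unfolding response_def matrix_matrix_mult_def
    by (intro continuous_intros)
qed

lemma continuous_on_response_reflected: "continuous_on {0..1} (\<lambda>\<tau>. response (1 - \<tau>))"
  by (rule continuous_on_compose2[OF continuous_on_response]) (auto intro!: continuous_intros)

lemma continuous_on_gramian_control: "continuous_on {0..1} (gramian_control p)"
  unfolding gramian_control_def matrix_vector_mult_def transpose_def
  by (intro continuous_intros continuous_on_response_reflected)

lemma control_integrand_gramian_control:
  assumes "\<tau> \<le> 1"
  shows "control_integrand system 1 (gramian_control p) \<tau>
    = (exp (- \<rho> * (1 - \<tau>)) * (1 - \<tau>) powr \<alpha>) *\<^sub>R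
        (response (1 - \<tau>) *v (transpose (response (1 - \<tau>)) *v p))"
proof -
  \<comment> \<open>At \<open>\<tau> = 1\<close> both sides are \<open>0\<close>, because \<open>0 powr x = 0\<close> for every \<open>x\<close>.\<close>
  have "(1 - \<tau>) powr (\<alpha> - 1) * (1 - \<tau>) = (1 - \<tau>) powr \<alpha>"
    using assms \<alpha>_pos by (cases "\<tau> = 1") (simp_all add: powr_diff)
  then show ?thesis
    by (simp add: control_integrand_system gramian_control_def matrix_vector_mult_scaleR mult.assoc)
qed

lemma continuous_on_control_integrand_gramian_control:
  "continuous_on {0..1} (control_integrand system 1 (gramian_control p))"
proof -
  have "continuous_on {0..1} (\<lambda>\<tau>. (exp (- \<rho> * (1 - \<tau>)) * (1 - \<tau>) powr \<alpha>) *\<^sub>R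
        (response (1 - \<tau>) *v (transpose (response (1 - \<tau>)) *v p)))"
    unfolding matrix_vector_mult_def transpose_def
    using \<alpha>_pos by (intro continuous_intros continuous_on_powr' continuous_on_response_reflected) auto
  then show ?thesis
    by (rule continuous_on_eq) (simp add: control_integrand_gramian_control)
qed

lemma integrable_gramian_control:
  "integrable (lebesgue_on {0..1}) (control_integrand system 1 (gramian_control p))"
  using continuous_imp_integrable_real[OF continuous_on_control_integrand_gramian_control] .

lemma gramian_control_in_control_domain: "gramian_control p \<in> control_domain system 1"
proof -
  have "gramian_control p \<in> borel_measurable (lebesgue_on {0..1})"
    using continuous_on_gramian_control by (rule continuous_imp_measurable_on_sets_lebesgue) simp
  moreover have "integrable (lebesgue_on {0..1}) (\<lambda>t. (norm (gramian_control p t))\<^sup>2)"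
    using continuous_on_gramian_control
    by (intro continuous_imp_integrable_real continuous_intros)
  ultimately show ?thesis
    by (simp add: control_domain_def L2_controls_def integrable_gramian_control)
qed

lemma linear_controllability_map_gramian_control:
  "linear (\<lambda>p. controllability_map system 1 (gramian_control p))"
proof (rule linearI)
  fix p q :: "real^'n" and c :: real
  have "control_integrand system 1 (gramian_control (p + q)) = (\<lambda>\<tau>.
      control_integrand system 1 (gramian_control p) \<tau> + control_integrand system 1 (gramian_control q) \<tau>)"
    by (rule ext)
      (simp add: control_integrand_system gramian_control_def matrix_vector_right_distrib
        matrix_vector_mult_scaleR scaleR_add_right)
  then show "controllability_map system 1 (gramian_control (p + q))
      = controllability_map system 1 (gramian_control p) + controllability_map system 1 (gramian_control q)"
    unfolding controllability_map_def by (simp add: integrable_gramian_control)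
  have "control_integrand system 1 (gramian_control (c *\<^sub>R p))
      = (\<lambda>\<tau>. c *\<^sub>R control_integrand system 1 (gramian_control p) \<tau>)"
    by (rule ext)
      (simp add: control_integrand_system gramian_control_def matrix_vector_mult_scaleR mult_ac)
  then show "controllability_map system 1 (gramian_control (c *\<^sub>R p))
      = c *\<^sub>R controllability_map system 1 (gramian_control p)"
    unfolding controllability_map_def by simp
qed

text \<open>The component of the image along \<open>p\<close> is the integral of a weight times the squared norm of
  \<open>(F s)\<^sup>T p\<close>. The integrand is continuous, so it vanishes pointwise and not only almost
  everywhere, and the power series in \<open>s\<^sup>\<alpha>\<close> yields the coefficients.\<close>

lemma gramian_kernel:
  assumes "controllability_map system 1 (gramian_control p) = 0"
  shows "p \<bullet> ((mat_power A l ** B) *v w) = 0"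
proof -
  let ?f = "control_integrand system 1 (gramian_control p)"
  let ?g = "\<lambda>\<tau>. p \<bullet> ?f \<tau>"
  have g: "?g \<tau> = exp (- \<rho> * (1 - \<tau>)) * (1 - \<tau>) powr \<alpha> * (norm (transpose (response (1 - \<tau>)) *v p))\<^sup>2"
    if "\<tau> \<le> 1" for \<tau>
    using that
    by (simp add: control_integrand_gramian_control power2_norm_eq_inner
        flip: dot_lmul_matrix)
  have cont: "continuous_on {0..1} ?g"
    by (intro continuous_intros continuous_on_control_integrand_gramian_control)
  have "integral\<^sup>L (lebesgue_on {0..1}) ?g = 0"
    using assms integrable_gramian_control[of p]
    by (simp add: controllability_map_def)
  then have "(?g has_integral 0) {0..1}"
    using has_integral_integral_lebesgue_on[OF continuous_imp_integrable_real[OF cont]] by simp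
  then have zero: "?g \<tau> = 0" if "\<tau> \<in> {0..1}" for \<tau>
    using that has_integral_0_cbox_imp_0[of 0 1 ?g \<tau>] cont by (simp add: g)
  have "transpose (response s) *v p = 0" if "0 < s" "s < 1" for s
    using zero[of "1 - s"] that by (simp add: g)
  then have s: "p \<bullet> (response s *v w) = 0" if "0 < s" "s < 1" for s
    using that transpose_vector_mult_eq_0_iff by blast
  have "p \<bullet> ((mittag_leffler \<alpha> \<alpha> (z *\<^sub>R A) ** B) *v w) = 0" if "0 < z" "z < 1" for z
  proof -
    \<comment> \<open>the time \<open>s\<close> with \<open>s powr \<alpha> = z\<close>\<close>
    have "z powr (1 / \<alpha>) < 1" "(z powr (1 / \<alpha>)) powr \<alpha> = z"
      using that \<alpha>_pos powr_less_mono2[of "1 / \<alpha>" z 1] by (simp_all add: powr_powr)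
    then show ?thesis
      using s[of "z powr (1 / \<alpha>)"] that by (simp add: response_def)
  qed
  then show ?thesis
    by (rule inner_powers_zero_if_mittag_leffler[OF \<alpha>_pos \<alpha>_pos zero_less_one])
qed

lemma inner_controllability_map_zero:
  assumes "u \<in> control_domain system T" and "\<And>l w. \<eta> \<bullet> ((mat_power A l ** B) *v w) = 0"
  shows "\<eta> \<bullet> controllability_map system T u = 0"
proof -
  have "\<eta> \<bullet> control_integrand system T u \<tau> = 0" for \<tau>
    by (simp add: control_integrand_def
        inner_mittag_leffler_zero_if_powers[OF \<alpha>_pos \<alpha>_pos assms(2)])
  then have "integral\<^sup>L (lebesgue_on {0..T}) (\<lambda>\<tau>. \<eta> \<bullet> control_integrand system T u \<tau>) = 0"
    by simp
  then show ?thesis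
    using assms(1) by (simp add: controllability_map_def control_domain_def)
qed

lemma controllable_iff_rank_kalman_matrix:
  "controllable system \<longleftrightarrow> rank (kalman_matrix A B) = CARD('n)"
proof
  assume "controllable system"
  then obtain T where T: "controllability_map system T ` control_domain system T = UNIV"
    by (auto simp: controllable_def)
  have "\<eta> = 0" if "\<And>l w. \<eta> \<bullet> ((mat_power A l ** B) *v w) = 0" for \<eta>
  proof -
    obtain u where "u \<in> control_domain system T" "\<eta> = controllability_map system T u"
      using T by blast
    then have "\<eta> \<bullet> \<eta> = 0"
      using inner_controllability_map_zero[of u T \<eta>] that by simp
    then show ?thesis
      by simp
  qed
  then show "rank (kalman_matrix A B) = CARD('n)"
    by (auto simp: rank_kalman_matrix_full_iff)
next
  assume "rank (kalman_matrix A B) = CARD('n)"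
  then have "p = 0" if "controllability_map system 1 (gramian_control p) = 0" for p
    using gramian_kernel[OF that] by (auto simp: rank_kalman_matrix_full_iff)
  then have "inj (\<lambda>p. controllability_map system 1 (gramian_control p))"
    using linear_injective_0[OF linear_controllability_map_gramian_control] by blast
  then have "surj (\<lambda>p. controllability_map system 1 (gramian_control p))"
    using linear_injective_imp_surjective[OF linear_controllability_map_gramian_control] by blast
  then have "controllability_map system 1 ` control_domain system 1 = UNIV"
    using gramian_control_in_control_domain by (auto 4 4 simp: surj_def)
  then show "controllable system"
    unfolding controllable_def by (intro exI[of _ 1]) simp
qed

end

theorem theorem3p3:
  fixes A :: "real^'n^'n" and B :: "real^'m^'n"
    and \<alpha> \<rho> :: real and N :: "real^'n^'n \<Rightarrow> real"
  assumes "0 < \<rho>" and "0 < \<alpha>" and "\<alpha> < 1"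
    and "matrix_norm N"
    and "\<forall>s::real. s \<ge> N A powr (1 / \<alpha>) \<longrightarrow> det ((s + \<rho>) powr \<alpha> *\<^sub>R mat 1 - A) \<noteq> 0"
  shows "controllable \<lparr>sys_order = \<alpha>, sys_tempering = \<rho>, sys_state = A, sys_input = B\<rparr>
         \<longleftrightarrow> rank (kalman_matrix A B) = CARD('n)"
  using assms(2) by (rule controllable_iff_rank_kalman_matrix)

end
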